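(* Let $u,v:\mathbb{C}\to\mathbb{R}$ be harmonic functions and let $f=u+iv:\mathbb{C}\to\mathbb{C}$, with range $\mathcal{R}_f=f(\mathbb{C})$. If the set of asymptotic directions $\mathcal{D}(\mathcal{R}_f)$ contains no pair of antipodal points (i.e. there is no $\zeta\in\partial\mathbb{D}$ with both $\zeta$ and $-\zeta$ in $\mathcal{D}(\mathcal{R}_f)$), then $f$ is constant.
   Context: $\mathbb{D}$ is the open unit disc and $\partial\mathbb{D}=\{e^{i\theta}:\theta\in\mathbb{R}\}$ the unit circle. For a set $\mathcal{R}\subset\mathbb{C}$, a point $e^{i\theta}\in\partial\mathbb{D}$ is an asymptotic direction of $\mathcal{R}$ if there exist points $w_n\in\mathcal{R}$ and positive numbers $\varepsilon_n\to 0$ with $\varepsilon_n w_n\to e^{i\theta}$; $\mathcal{D}(\mathcal{R})$ denotes the set of asymptotic directions of $\mathcal{R}$. A harmonic map $f=u+iv$ is just a pair of real harmonic functions on $\mathbb{C}$ (no univalence assumed). *)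

theory Defs
  imports "HOL-Analysis.Analysis"
begin

definition harmonic :: "(complex \<Rightarrow> real) \<Rightarrow> bool" where
  "harmonic u \<longleftrightarrow>
     (\<exists>ux uy uxx uxy uyx uyy.
        (\<forall>z. (u has_derivative (\<lambda>h. ux z * Re h + uy z * Im h)) (at z)) \<and>
        (\<forall>z. (ux has_derivative (\<lambda>h. uxx z * Re h + uxy z * Im h)) (at z)) \<and>
        (\<forall>z. (uy has_derivative (\<lambda>h. uyx z * Re h + uyy z * Im h)) (at z)) \<and>
        continuous_on UNIV uxx \<and> continuous_on UNIV uxy \<and>
        continuous_on UNIV uyx \<and> continuous_on UNIV uyy \<and>
        (\<forall>z. uxx z + uyy z = 0))"

definition asymptotic_direction :: "complex set \<Rightarrow> complex \<Rightarrow> bool" where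
  "asymptotic_direction R \<zeta> \<longleftrightarrow> norm \<zeta> = 1 \<and>
     (\<exists>w :: nat \<Rightarrow> complex. \<exists>\<epsilon> :: nat \<Rightarrow> real.
        (\<forall>n. w n \<in> R \<and> \<epsilon> n > 0) \<and> \<epsilon> \<longlonglongrightarrow> 0 \<and>
        (\<lambda>n. of_real (\<epsilon> n) * w n) \<longlonglongrightarrow> \<zeta>)"

definition asymptotic_directions :: "complex set \<Rightarrow> complex set" where
  "asymptotic_directions R = {\<zeta>. asymptotic_direction R \<zeta>}"

end

theory Submission
  imports Defs "HOL-Complex_Analysis.Complex_Analysis"
begin

text \<open>Write \<open>u = Re G\<close> and \<open>v = Re H\<close> with \<open>G\<close>, \<open>H\<close> entire. The set of asymptotic directions is closed and
  the circle is connected, so after a rotation neither \<open>\<i>\<close> nor \<open>- \<i>\<close> is an asymptotic direction; hence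
  \<open>\<bar>v\<bar> \<le> C (1 + \<bar>u\<bar>)\<close>. If \<open>u\<close> is not constant, an argument of J. Lewis based on Harnack's inequality
  gives discs centred at zeros of \<open>u\<close> on which \<open>u\<close> is arbitrarily large but satisfies a doubling
  condition. Rescaling on these discs and passing to a limit by Montel's theorem yields a nonconstant
  pair \<open>(Re g, Re h)\<close> whose values all point in asymptotic directions, and which therefore vanishes at
  the origin. Its leading homogeneous term there has some degree \<open>n \<ge> 1\<close>, so it changes sign when
  \<open>z\<close> is rotated by \<open>\<pi> / n\<close>: two antipodal asymptotic directions.\<close>

subsection \<open>Harmonic functions as real parts of entire functions\<close>

text \<open>Two uses of the mean value theorem: in direction \<open>d\<close> for the increment of
  \<open>u\<close> across \<open>of_real h * e\<close>, then in direction \<open>e\<close> for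
  \<open>p\<close>. The left-hand side is symmetric in \<open>d\<close> and \<open>e\<close>, so it
  can be expanded in either order.\<close>

lemma second_difference_mean_value:
  fixes u p r :: "complex \<Rightarrow> real" and d e :: complex
  assumes u: "\<And>z. ((\<lambda>s. u (z + of_real s * d)) has_real_derivative p z) (at 0)"
    and p: "\<And>z. ((\<lambda>s. p (z + of_real s * e)) has_real_derivative r z) (at 0)"
    and "0 < h"
  obtains s t where "0 < s" "s < h" "0 < t" "t < h"
    "u (z + of_real h * d + of_real h * e) - u (z + of_real h * d) - u (z + of_real h * e) + u z
      = h * h * r (z + of_real s * d + of_real t * e)"
proof -
  \<comment> \<open>Moving the base point along the line turns a derivative at parameter 0 into one
    at any parameter \<open>x\<close>.\<close>
  have line: "((\<lambda>s. f (z + of_real s * d)) has_real_derivative f' (z + of_real x * d)) (at x)"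
    if "\<And>z. ((\<lambda>s. f (z + of_real s * d)) has_real_derivative f' z) (at 0)"
    for f f' :: "complex \<Rightarrow> real" and x :: real and z d :: complex
  proof -
    have "((\<lambda>s. f ((z + of_real x * d) + of_real s * d)) has_real_derivative f' (z + of_real x * d)) (at (x - x))"
      using that by simp
    then have "((\<lambda>s. f ((z + of_real x * d) + of_real (s - x) * d)) has_real_derivative f' (z + of_real x * d)) (at x)"
      using DERIV_shift[of "\<lambda>s. f ((z + of_real x * d) + of_real (s - x) * d)" "f' (z + of_real x * d)" 0 x]
      by (simp add: add.commute)
    then show ?thesis by (simp add: algebra_simps)
  qed
  define \<phi> where "\<phi> s = u (z + of_real h * e + of_real s * d) - u (z + of_real s * d)" for s
  have "(\<phi> has_real_derivative (p (z + of_real h * e + of_real s * d) - p (z + of_real s * d))) (at s)" for s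
    unfolding \<phi>_def by (rule DERIV_diff[OF line[where f = u and f' = p, OF u] line[where f = u and f' = p, OF u]])
  from MVT2[of 0 h \<phi>, OF \<open>0 < h\<close> this] obtain s where s: "0 < s" "s < h"
    and s': "\<phi> h - \<phi> 0 = h * (p (z + of_real h * e + of_real s * d) - p (z + of_real s * d))"
    by auto
  have "((\<lambda>t. p ((z + of_real s * d) + of_real t * e)) has_real_derivative
      r ((z + of_real s * d) + of_real t * e)) (at t)" for t
    by (rule line[where f = p and f' = r, OF p])
  from MVT2[of 0 h, OF \<open>0 < h\<close> this] obtain t where t: "0 < t" "t < h"
    and t': "p (z + of_real s * d + of_real h * e) - p (z + of_real s * d)
       = h * r (z + of_real s * d + of_real t * e)"
    by auto
  show thesis
    by (rule that[OF s t]) (use s' t' in \<open>simp add: \<phi>_def algebra_simps\<close>)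
qed

lemma has_derivative_along_line:
  fixes u :: "complex \<Rightarrow> real"
  assumes "(u has_derivative u') (at z)"
  shows "((\<lambda>s. u (z + of_real s * d)) has_real_derivative u' d) (at 0)"
proof -
  have "((\<lambda>s::real. z + of_real s * d) has_derivative (\<lambda>s. of_real s * d)) (at 0)"
    by (auto intro!: derivative_eq_intros)
  moreover have "(u has_derivative u') (at (z + of_real 0 * d))"
    using assms by simp
  ultimately have "((\<lambda>s. u (z + of_real s * d)) has_derivative (\<lambda>s. u' (of_real s * d))) (at 0)"
    by (rule has_derivative_compose)
  moreover have "u' (of_real s * d) = u' d * s" for s
    using linear_cmul[OF has_derivative_linear[OF assms], of s d]
    by (simp add: scaleR_conv_of_real)
  ultimately show ?thesis
    by (simp add: has_field_derivative_def)
qed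

text \<open>Symmetry of second derivatives: the same second difference, expanded in both orders and
  divided by the square of the step, gives equal values of \<open>r\<close> and \<open>r'\<close> at
  points tending to \<open>z\<close>; continuity finishes.\<close>

lemma mixed_partials_eq:
  fixes u p q r r' :: "complex \<Rightarrow> real" and d e :: complex
  assumes u: "\<And>z. ((\<lambda>s. u (z + of_real s * d)) has_real_derivative p z) (at 0)"
             "\<And>z. ((\<lambda>s. u (z + of_real s * e)) has_real_derivative q z) (at 0)"
    and p: "\<And>z. ((\<lambda>s. p (z + of_real s * e)) has_real_derivative r z) (at 0)"
    and q: "\<And>z. ((\<lambda>s. q (z + of_real s * d)) has_real_derivative r' z) (at 0)"
    and cont: "isCont r z" "isCont r' z"
  shows "r z = r' z"
proof -
  define h where "h n = 1 / (real n + 1)" for n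
  have h: "0 < h n" for n by (simp add: h_def)
  have h0: "h \<longlonglongrightarrow> 0"
    unfolding h_def using LIMSEQ_inverse_real_of_nat by (simp add: inverse_eq_divide add.commute)
  have "\<exists>s t s' t'. 0 < s \<and> s < h n \<and> 0 < t \<and> t < h n \<and> 0 < s' \<and> s' < h n \<and> 0 < t' \<and> t' < h n \<and>
      r (z + of_real s * d + of_real t * e) = r' (z + of_real s' * e + of_real t' * d)" for n
  proof -
    obtain s t where 1: "0 < s" "s < h n" "0 < t" "t < h n"
      "u (z + of_real (h n) * d + of_real (h n) * e) - u (z + of_real (h n) * d) - u (z + of_real (h n) * e) + u z
        = h n * h n * r (z + of_real s * d + of_real t * e)"
      using second_difference_mean_value[OF u(1) p h, where z = z] by metis
    obtain s' t' where 2: "0 < s'" "s' < h n" "0 < t'" "t' < h n"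
      "u (z + of_real (h n) * e + of_real (h n) * d) - u (z + of_real (h n) * e) - u (z + of_real (h n) * d) + u z
        = h n * h n * r' (z + of_real s' * e + of_real t' * d)"
      using second_difference_mean_value[OF u(2) q h, where z = z] by metis
    have "h n * h n * r (z + of_real s * d + of_real t * e) = h n * h n * r' (z + of_real s' * e + of_real t' * d)"
      using 1(5) 2(5) by (simp add: algebra_simps)
    then have "r (z + of_real s * d + of_real t * e) = r' (z + of_real s' * e + of_real t' * d)"
      using h[of n] by simp
    with 1 2 show ?thesis by blast
  qed
  then obtain s t s' t' where *: "\<And>n. 0 < s n" "\<And>n. s n < h n" "\<And>n. 0 < t n" "\<And>n. t n < h n"
      "\<And>n. 0 < s' n" "\<And>n. s' n < h n" "\<And>n. 0 < t' n" "\<And>n. t' n < h n" and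
      eq: "\<And>n. r (z + of_real (s n) * d + of_real (t n) * e) = r' (z + of_real (s' n) * e + of_real (t' n) * d)"
    by metis
  have to0: "x \<longlonglongrightarrow> 0" if "\<And>n. 0 < x n" "\<And>n. x n < h n" for x :: "nat \<Rightarrow> real"
    by (rule real_tendsto_sandwich[OF _ _ tendsto_const h0]) (auto simp: that less_imp_le)
  note lims = to0[OF *(1,2)] to0[OF *(3,4)] to0[OF *(5,6)] to0[OF *(7,8)]
  have "(\<lambda>n. z + of_real (s n) * d + of_real (t n) * e) \<longlonglongrightarrow> z + of_real 0 * d + of_real 0 * e"
    by (intro tendsto_intros lims)
  then have A: "(\<lambda>n. r (z + of_real (s n) * d + of_real (t n) * e)) \<longlonglongrightarrow> r z"
    using isCont_tendsto_compose[OF cont(1)] by simp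
  have "(\<lambda>n. z + of_real (s' n) * e + of_real (t' n) * d) \<longlonglongrightarrow> z + of_real 0 * e + of_real 0 * d"
    by (intro tendsto_intros lims)
  then have B: "(\<lambda>n. r' (z + of_real (s' n) * e + of_real (t' n) * d)) \<longlonglongrightarrow> r' z"
    using isCont_tendsto_compose[OF cont(2)] by simp
  show ?thesis
    using LIMSEQ_unique[OF A] B by (simp add: eq)
qed

text \<open>If \<open>u = Re G\<close> then the derivative of \<open>G\<close> must be
  \<open>ux - \<i> * uy\<close>. This function satisfies the Cauchy-Riemann equations by Laplace's
  equation and the symmetry of mixed partials, so it has a primitive on the plane, whose real part
  has the same differential as \<open>u\<close>.\<close>

lemma harmonic_imp_Re_entire:
  assumes "harmonic u"
  obtains G where "G holomorphic_on UNIV" "\<And>z. u z = Re (G z)"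
proof -
  obtain ux uy uxx uxy uyx uyy where
    u: "\<And>z. (u has_derivative (\<lambda>h. ux z * Re h + uy z * Im h)) (at z)" and
    ux: "\<And>z. (ux has_derivative (\<lambda>h. uxx z * Re h + uxy z * Im h)) (at z)" and
    uy: "\<And>z. (uy has_derivative (\<lambda>h. uyx z * Re h + uyy z * Im h)) (at z)" and
    cont: "continuous_on UNIV uxy" "continuous_on UNIV uyx" and
    lap: "\<And>z. uxx z + uyy z = 0"
    using assms unfolding harmonic_def by blast
  have sym: "uxy z = uyx z" for z
  proof (rule mixed_partials_eq[of u 1 ux \<i> uy])
    show "((\<lambda>s. u (z + of_real s * 1)) has_real_derivative ux z) (at 0)" for z
      using has_derivative_along_line[OF u, of z 1] by simp
    show "((\<lambda>s. u (z + of_real s * \<i>)) has_real_derivative uy z) (at 0)" for z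
      using has_derivative_along_line[OF u, of z \<i>] by simp
    show "((\<lambda>s. ux (z + of_real s * \<i>)) has_real_derivative uxy z) (at 0)" for z
      using has_derivative_along_line[OF ux, of z \<i>] by simp
    show "((\<lambda>s. uy (z + of_real s * 1)) has_real_derivative uyx z) (at 0)" for z
      using has_derivative_along_line[OF uy, of z 1] by simp
  qed (use cont in \<open>auto simp: continuous_on_eq_continuous_at\<close>)
  define p where "p z = of_real (ux z) - \<i> * of_real (uy z)" for z
  have "(p has_field_derivative (of_real (uxx z) - \<i> * of_real (uyx z))) (at z)" for z
  proof -
    have "(p has_derivative (\<lambda>h. of_real (uxx z * Re h + uxy z * Im h) - \<i> * of_real (uyx z * Re h + uyy z * Im h))) (at z)"
      unfolding p_def by (auto intro!: derivative_eq_intros ux uy)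
    moreover have "uyy z = - uxx z" using lap[of z] by linarith
    then have "(\<lambda>h. of_real (uxx z * Re h + uxy z * Im h) - \<i> * of_real (uyx z * Re h + uyy z * Im h))
        = (\<lambda>h. (of_real (uxx z) - \<i> * of_real (uyx z)) * h)"
      by (auto simp: fun_eq_iff complex_eq_iff sym)
    ultimately show ?thesis by (simp add: has_field_derivative_def)
  qed
  then have "p holomorphic_on UNIV"
    using holomorphic_on_open open_UNIV by blast
  then obtain G where G: "\<And>z. (G has_field_derivative p z) (at z)"
    using holomorphic_convex_primitive'[of UNIV p] by auto
  have "((\<lambda>z. u z - Re (G z)) has_derivative (\<lambda>h. 0)) (at z)" for z
  proof -
    have "(G has_derivative (\<lambda>h. p z * h)) (at z)"
      using G by (simp add: has_field_derivative_def)
    then have "((\<lambda>z. u z - Re (G z)) has_derivative (\<lambda>h. (ux z * Re h + uy z * Im h) - Re (p z * h))) (at z)"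
      by (auto intro!: derivative_eq_intros u)
    then show ?thesis by (simp add: p_def)
  qed
  then have "\<exists>c. \<forall>z\<in>UNIV. u z - Re (G z) = c"
    by (intro has_derivative_zero_constant) auto
  then obtain c where c: "\<And>z. u z - Re (G z) = c" by blast
  show thesis
  proof
    show "(\<lambda>z. G z + of_real c) holomorphic_on UNIV"
      using G by (intro holomorphic_intros) (metis holomorphic_on_open open_UNIV)
    show "u z = Re (G z + of_real c)" for z
      using c[of z] by simp
  qed
qed

subsection \<open>Harnack's inequality and doubling discs\<close>

text \<open>The Moebius map of the right half-plane onto the unit disc that sends \<open>G a\<close>
  to 0 makes Schwarz's lemma applicable; at half the radius it gives modulus at most 1/2, and
  solving back for \<open>G z\<close> produces the factor 3.\<close>

lemma Re_pos_norm_le: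
  assumes G: "G holomorphic_on ball a r"
    and pos: "\<And>z. z \<in> ball a r \<Longrightarrow> 0 < Re (G z)"
    and z: "dist a z \<le> r / 2" and r: "0 < r"
  shows "norm (G z - \<i> * Im (G a)) \<le> 3 * Re (G a)"
proof -
  define \<phi> where "\<phi> w = (G (a + of_real r * w) - G a) / (G (a + of_real r * w) + cnj (G a))" for w
  have mem: "a + of_real r * w \<in> ball a r" if "norm w < 1" for w
    using that r by (simp add: dist_norm norm_mult)
  have a: "0 < Re (G a)" using pos r by simp
  have nz: "G (a + of_real r * w) + cnj (G a) \<noteq> 0" if "norm w < 1" for w
    using pos[OF mem[OF that]] a by (auto simp: complex_eq_iff)
  \<comment> \<open>The squared norms differ by \<open>4 * Re X * Re Y\<close>.\<close>
  have less: "norm (X - Y) < norm (X + cnj Y)" if "0 < Re X" "0 < Re Y" for X Y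
  proof -
    have "(norm (X - Y))\<^sup>2 < (norm (X + cnj Y))\<^sup>2"
      using that mult_pos_pos[OF that] unfolding cmod_power2 by (simp add: power2_eq_square algebra_simps)
    then show ?thesis by (rule power_less_imp_less_base) simp
  qed
  have "G \<circ> (\<lambda>w. a + of_real r * w) holomorphic_on ball 0 1"
    using mem by (intro holomorphic_on_compose_gen[OF _ G]) (auto intro!: holomorphic_intros)
  then have "\<phi> holomorphic_on ball 0 1"
    unfolding \<phi>_def o_def using nz by (intro holomorphic_intros) auto
  moreover have "\<phi> 0 = 0" by (simp add: \<phi>_def)
  moreover have "norm (\<phi> w) < 1" if "norm w < 1" for w
    using less[OF pos[OF mem[OF that]] a] nz[OF that] by (simp add: \<phi>_def norm_divide)
  moreover define w where "w = (z - a) / of_real r"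
  have w: "norm w \<le> 1 / 2"
    using z r by (simp add: w_def norm_divide dist_norm norm_minus_commute field_simps)
  then have w1: "norm w < 1" by simp
  ultimately have "norm (\<phi> w) \<le> norm w"
    using Schwarz_Lemma(1) by blast
  with w have half: "norm (\<phi> w) \<le> 1 / 2" by simp
  have zw: "a + of_real r * w = z" using r by (simp add: w_def)
  \<comment> \<open>Removing the imaginary part of \<open>G a\<close> makes the Moebius quotient
    \<open>(F - x) / (F + x)\<close> with \<open>x = Re (G a)\<close> real, whence
    \<open>norm F - x \<le> (norm F + x) / 2\<close>.\<close>
  define F where "F = G z - \<i> * Im (G a)"
  have ga: "G a = of_real (Re (G a)) + \<i> * Im (G a)" by (simp add: complex_eq_iff)
  have 1: "G z - G a = F - of_real (Re (G a))" by (subst ga) (simp add: F_def)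
  have 2: "G z + cnj (G a) = F + of_real (Re (G a))" by (subst ga) (simp add: F_def complex_eq_iff)
  have "F - of_real (Re (G a)) = \<phi> w * (F + of_real (Re (G a)))"
    using nz[OF w1] 1 2 unfolding zw \<phi>_def by simp
  then have "norm (F - of_real (Re (G a))) \<le> 1 / 2 * norm (F + of_real (Re (G a)))"
    using mult_right_mono[OF half norm_ge_zero] by (simp only: norm_mult)
  also have "\<dots> \<le> 1 / 2 * (norm F + Re (G a))"
    using norm_triangle_ineq[of F "of_real (Re (G a))"] a by simp
  finally have "norm F - Re (G a) \<le> 1 / 2 * (norm F + Re (G a))"
    using norm_triangle_ineq2[of F "of_real (Re (G a))"] a by simp
  then show ?thesis unfolding F_def by simp
qed

text \<open>Adding \<open>2 * M\<close> makes the real part positive. The half-plane estimate then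
  gives at most \<open>3 * (M + 2 * M)\<close>, and undoing the shift costs another
  \<open>2 * M\<close>: in total \<open>11 * M\<close>.\<close>

lemma Borel_Caratheodory_bound:
  assumes G: "G holomorphic_on ball a r"
    and bd: "\<And>z. z \<in> ball a r \<Longrightarrow> \<bar>Re (G z)\<bar> \<le> M"
    and z: "dist a z \<le> r / 2" and r: "0 < r" and M: "0 < M"
  shows "norm (G z - \<i> * Im (G a)) \<le> 11 * M"
proof -
  have "norm (G z + of_real (2 * M) - \<i> * Im (G a + of_real (2 * M))) \<le> 3 * Re (G a + of_real (2 * M))"
  proof (rule Re_pos_norm_le[OF _ _ z r])
    show "0 < Re (G z + of_real (2 * M))" if "z \<in> ball a r" for z
      using bd[OF that] M by simp
  qed (intro holomorphic_intros G)
  moreover have "\<bar>Re (G a)\<bar> \<le> M" using bd r by simp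
  moreover have "norm (G z - \<i> * Im (G a)) \<le> norm (G z + of_real (2 * M) - \<i> * Im (G a)) + norm (of_real (2 * M) :: complex)"
    by (metis (no_types, opaque_lifting) add_diff_cancel_right' diff_diff_eq add.commute norm_triangle_ineq4)
  ultimately show ?thesis using M by simp
qed

text \<open>After a shift making the real part at least 1, the half-plane estimate on a disc about 0
  of radius more than \<open>2 * norm z\<close> bounds the value at \<open>z\<close> in terms of the
  value at 0 alone, so Liouville's theorem applies.\<close>

lemma Re_bounded_below_imp_constant:
  assumes G: "G holomorphic_on UNIV" and pos: "\<And>z. B \<le> Re (G z)"
  shows "G z = G 0"
proof -
  define G' where "G' z = G z - of_real (B - 1)" for z
  have "bounded (range G')"
  proof -
    have "norm (G' z - \<i> * Im (G' 0)) \<le> 3 * Re (G' 0)" for z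
    proof (rule Re_pos_norm_le[where G = G' and a = 0 and r = "2 * norm z + 1"])
      show "G' holomorphic_on ball 0 (2 * norm z + 1)"
        unfolding G'_def using G by (intro holomorphic_intros) (auto intro: holomorphic_on_subset[OF _ subset_UNIV])
      show "0 < Re (G' z)" for z using pos[of z] by (simp add: G'_def)
    qed (auto simp: dist_norm intro: add_nonneg_pos)
    then have "norm (G' z) \<le> 3 * Re (G' 0) + norm (\<i> * Im (G' 0))" for z
      by (smt (verit) norm_triangle_ineq2)
    then show ?thesis by (auto simp: bounded_iff)
  qed
  moreover have "G' holomorphic_on UNIV"
    unfolding G'_def by (intro holomorphic_intros G)
  ultimately obtain c where "\<And>z. G' z = c"
    using Liouville_theorem by (metis constant_on_def UNIV_I)
  then show ?thesis unfolding G'_def by (metis diff_add_cancel)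
qed

lemma Re_bounded_above_imp_constant:
  assumes G: "G holomorphic_on UNIV" and neg: "\<And>z. Re (G z) \<le> B"
  shows "G z = G 0"
proof -
  have "- G z = - G 0"
    by (rule Re_bounded_below_imp_constant[where B = "- B"]) (use assms in \<open>auto intro: holomorphic_intros\<close>)
  then show ?thesis by simp
qed

lemma Re_nonzero_constant_sign:
  assumes S: "connected S" "continuous_on S G" and nz: "\<And>z. z \<in> S \<Longrightarrow> Re (G z) \<noteq> 0"
  shows "(\<forall>z\<in>S. 0 < Re (G z)) \<or> (\<forall>z\<in>S. Re (G z) < 0)"
proof (rule ccontr)
  assume "\<not> ?thesis"
  then obtain x y where xy: "x \<in> S" "y \<in> S" "Re (G x) \<le> 0" "0 \<le> Re (G y)"
    by (auto simp: not_less)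
  have "connected ((\<lambda>z. Re (G z)) ` S)"
    using S by (intro connected_continuous_image continuous_intros)
  then have "0 \<in> (\<lambda>z. Re (G z)) ` S"
    using xy unfolding connected_iff_interval by blast
  then show False using nz by auto
qed

text \<open>By connectedness \<open>Re G\<close> has one sign on the disc, so the half-plane
  estimate applies to \<open>G\<close> or to \<open>- G\<close>.\<close>

lemma Harnack_Re:
  assumes G: "G holomorphic_on ball a r"
    and nz: "\<And>z. z \<in> ball a r \<Longrightarrow> Re (G z) \<noteq> 0"
    and z: "dist a z \<le> r / 2" and r: "0 < r"
  shows "\<bar>Re (G z)\<bar> \<le> 3 * \<bar>Re (G a)\<bar>"
proof -
  have key: "\<bar>Re (F z)\<bar> \<le> 3 * \<bar>Re (F a)\<bar>"
    if F: "F holomorphic_on ball a r" "\<And>z. z \<in> ball a r \<Longrightarrow> 0 < Re (F z)" for F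
  proof -
    have "\<bar>Re (F z)\<bar> \<le> norm (F z - \<i> * Im (F a))"
      using abs_Re_le_cmod[of "F z - \<i> * Im (F a)"] by simp
    also have "\<dots> \<le> 3 * Re (F a)" by (rule Re_pos_norm_le[OF F z r])
    finally show ?thesis by linarith
  qed
  have "(\<forall>z\<in>ball a r. 0 < Re (G z)) \<or> (\<forall>z\<in>ball a r. Re (G z) < 0)"
    by (rule Re_nonzero_constant_sign) (use G nz in \<open>auto intro: holomorphic_on_imp_continuous_on\<close>)
  then show ?thesis
  proof
    assume "\<forall>z\<in>ball a r. 0 < Re (G z)"
    then show ?thesis using key[OF G] by blast
  next
    assume "\<forall>z\<in>ball a r. Re (G z) < 0"
    then show ?thesis using key[of "\<lambda>z. - G z"] G by (simp add: holomorphic_on_minus)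
  qed
qed

text \<open>The idea is Lewis's: among all zeros \<open>z\<close> of \<open>Re G\<close> in the disc of radius \<open>R\<close>, take one that nearly
  maximises the size of \<open>Re G\<close> on the disc about \<open>z\<close> of radius \<open>(R - norm z) / 10\<close>. The constant
  \<open>3 ^ 32\<close> comes from a chain of 32 applications of Harnack's inequality.\<close>
lemma doubling_ball:
  assumes G: "G holomorphic_on UNIV" and G0: "Re (G 0) = 0"
    and w0: "Re (G w0) \<noteq> 0"
  obtains z r \<gamma> w where "Re (G z) = 0" "0 < r" "\<bar>Re (G w0)\<bar> \<le> \<gamma>"
    "dist z w \<le> r" "\<gamma> / 2 \<le> \<bar>Re (G w)\<bar>"
    "\<And>x. x \<in> ball z (4 * r) \<Longrightarrow> \<bar>Re (G x)\<bar> \<le> 3 ^ 32 * \<gamma>"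
proof -
  \<comment> \<open>This radius puts \<open>w0\<close> in the disc about the zero 0 of radius
    \<open>R / 10\<close>, so that \<open>A\<close> contains the value at \<open>w0\<close>.\<close>
  define R where "R = 10 * norm w0 + 1"
  define A where "A = {\<bar>Re (G w)\<bar> | w z. norm z < R \<and> Re (G z) = 0 \<and> dist z w \<le> (R - norm z) / 10}"
  define \<gamma> where "\<gamma> = Sup A"
  have contG: "continuous_on S G" for S
    using G holomorphic_on_imp_continuous_on holomorphic_on_subset by blast
  have "compact ((\<lambda>w. \<bar>Re (G w)\<bar>) ` cball 0 R)"
    by (intro compact_continuous_image continuous_intros contG) simp
  moreover have "A \<subseteq> (\<lambda>w. \<bar>Re (G w)\<bar>) ` cball 0 R"
  proof -
    have "norm w \<le> R" if "norm z < R" "dist z w \<le> (R - norm z) / 10" for w z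
      using that norm_triangle_ineq2[of w z] by (simp add: dist_norm norm_minus_commute)
    then show ?thesis unfolding A_def by (auto intro!: imageI simp del: divide_le_eq_numeral1 le_divide_eq_numeral1)
  qed
  ultimately have bdd: "bdd_above A"
    by (meson bdd_above_mono bounded_imp_bdd_above compact_imp_bounded)
  have w0A: "\<bar>Re (G w0)\<bar> \<in> A"
    unfolding A_def using G0
    by (intro CollectI exI[of _ w0] exI[of _ 0]) (auto simp: R_def add_nonneg_pos)
  then have \<gamma>: "\<bar>Re (G w0)\<bar> \<le> \<gamma>"
    unfolding \<gamma>_def by (rule cSup_upper[OF _ bdd])
  with w0 have \<gamma>0: "0 < \<gamma>" by linarith
  then have "\<gamma> / 2 < Sup A" by (simp add: \<gamma>_def)
  then obtain w z where z: "norm z < R" "Re (G z) = 0" "dist z w \<le> (R - norm z) / 10"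
    and w: "\<gamma> / 2 < \<bar>Re (G w)\<bar>"
    using less_cSup_iff[OF _ bdd, of "\<gamma> / 2"] w0A unfolding A_def by blast
  define r where "r = (R - norm z) / 10"
  have r: "0 < r" using z by (simp add: r_def)
  \<comment> \<open>The zero \<open>z'\<close> lies within \<open>4.5 * r\<close> of
    \<open>z\<close>, so \<open>R - norm z'\<close> is at least \<open>5.5 * r\<close>. The disc
    that \<open>A\<close> allows about \<open>z'\<close> then has radius at least
    \<open>0.55 * r\<close> and contains \<open>x\<close>.\<close>
  have near: "\<bar>Re (G x)\<bar> \<le> \<gamma>"
    if "x \<in> ball z (4 * r)" "Re (G z') = 0" "dist x z' < r / 2" for x z'
  proof -
    have "norm z' \<le> norm z + 4.5 * r"
    proof -
      have "dist z z' \<le> 4.5 * r"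
        using that dist_triangle[of z z' x] by simp
      then show ?thesis
        using norm_triangle_ineq2[of z' z] by (simp add: dist_norm norm_minus_commute)
    qed
    moreover have "10 * r = R - norm z" by (simp add: r_def)
    ultimately have z': "norm z' \<le> R - 5.5 * r" by simp
    then have "norm z' < R" using r by simp
    moreover have "dist z' x \<le> (R - norm z') / 10"
      using z' r that(3) by (simp add: dist_commute)
    ultimately have "\<bar>Re (G x)\<bar> \<in> A" unfolding A_def using that(2) by blast
    then show ?thesis unfolding \<gamma>_def by (rule cSup_upper[OF _ bdd])
  qed
  text \<open>Walk from \<open>x\<close> towards the zero \<open>z\<close>, paying a factor 3 by Harnack's inequality at each step,
    until some zero is within \<open>r / 2\<close>.\<close>
  have chain: "\<bar>Re (G x)\<bar> \<le> 3 ^ k * \<gamma>"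
    if "x \<in> ball z (4 * r)" "dist x z \<le> real k * (r / 8)" for k x
    using that
  proof (induction k arbitrary: x)
    case 0
    then show ?case using z \<gamma>0 by simp
  next
    case (Suc k)
    show ?case
    proof (cases "\<exists>z'. Re (G z') = 0 \<and> dist x z' < r / 2")
      case True
      then have "\<bar>Re (G x)\<bar> \<le> \<gamma>" using near Suc.prems by blast
      also have "\<dots> \<le> 3 ^ Suc k * \<gamma>"
        using \<gamma>0 one_le_power[of "3::real" "Suc k"] by (simp del: power_Suc)
      finally show ?thesis .
    next
      case False
      then have far: "r / 2 \<le> dist x z" using z by force
      define d where "d = dist x z"
      define x' where "x' = x + of_real (r / 8 / d) * (z - x)"
      have d: "r / 2 \<le> d" "0 < d" using far r by (auto simp: d_def)
      have xx': "dist x x' = r / 8"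
        using d r by (simp add: x'_def d_def dist_norm norm_mult norm_divide norm_minus_commute)
      have "x' - z = of_real (1 - r / 8 / d) * (x - z)"
        unfolding x'_def by (simp only: of_real_diff of_real_1) algebra
      moreover have "0 \<le> 1 - r / 8 / d" using d r by (simp add: field_simps)
      ultimately have "dist x' z = (1 - r / 8 / d) * d"
        by (simp add: dist_norm norm_mult d_def del: of_real_diff of_real_divide)
      also have "\<dots> = d - r / 8" using d by (simp add: field_simps)
      finally have x'z: "dist x' z = d - r / 8" .
      then have "\<bar>Re (G x')\<bar> \<le> 3 ^ k * \<gamma>"
        using Suc.prems r by (intro Suc.IH) (auto simp: d_def dist_commute algebra_simps)
      \<comment> \<open>The disc of radius \<open>r / 4\<close> about \<open>x'\<close> stays within
        \<open>3 * r / 8\<close> of \<open>x\<close>, hence is free of zeros, and \<open>x\<close>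
        lies at exactly half its radius.\<close>
      moreover have "\<bar>Re (G x)\<bar> \<le> 3 * \<bar>Re (G x')\<bar>"
      proof (rule Harnack_Re[where G = G and a = x' and r = "r / 4"])
        show "Re (G y) \<noteq> 0" if "y \<in> ball x' (r / 4)" for y
        proof -
          have "dist x y < r / 2"
            using that dist_triangle[of x y x'] xx' r by simp
          then show ?thesis using False by blast
        qed
      qed (use G r xx' in \<open>auto intro: holomorphic_on_subset simp: dist_commute\<close>)
      ultimately show ?thesis by simp
    qed
  qed
  show thesis
  proof
    \<comment> \<open>The distance to \<open>z\<close> is below \<open>4 * r\<close>, which is 32
      steps of length \<open>r / 8\<close>.\<close>
    show "\<bar>Re (G x)\<bar> \<le> 3 ^ 32 * \<gamma>" if "x \<in> ball z (4 * r)" for x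
      using that chain[of x 32] by (simp add: dist_commute)
  qed (use r z w \<gamma> in \<open>auto simp: r_def\<close>)
qed

subsection \<open>Blowing up\<close>

text \<open>The uniform bound that makes the rescaled functions a normal family;
  \<open>norm \<zeta> \<le> 2\<close> corresponds to half the radius \<open>4 * r\<close>.\<close>

lemma rescaled_bound:
  assumes G: "G holomorphic_on UNIV"
    and bd: "\<And>x. x \<in> ball z (4 * r) \<Longrightarrow> \<bar>Re (G x)\<bar> \<le> M"
    and r: "0 < r" and M: "0 < M" and \<zeta>: "norm \<zeta> \<le> 2"
  shows "norm ((G (z + of_real r * \<zeta>) - \<i> * Im (G z)) / of_real M) \<le> 11"
proof -
  have "norm (G (z + of_real r * \<zeta>) - \<i> * Im (G z)) \<le> 11 * M"
  proof (rule Borel_Caratheodory_bound[where G = G and a = z and r = "4 * r"])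
    show "G holomorphic_on ball z (4 * r)" using G holomorphic_on_subset by blast
    show "dist z (z + of_real r * \<zeta>) \<le> 4 * r / 2"
      using \<zeta> r by (simp add: dist_norm norm_mult)
  qed (use bd r M in auto)
  then show ?thesis using M by (simp add: norm_divide field_simps)
qed

lemma holomorphic_rescaled:
  assumes "G holomorphic_on UNIV"
  shows "(\<lambda>\<zeta>. (G (z + r * \<zeta>) - c) / M) holomorphic_on S"
proof -
  have "G \<circ> (\<lambda>\<zeta>. z + r * \<zeta>) holomorphic_on S"
    by (rule holomorphic_on_compose_gen[OF _ assms]) (auto intro!: holomorphic_intros)
  then show ?thesis
    \<comment> \<open>For \<open>M = 0\<close> the quotient is identically 0 by the convention for
      division.\<close>
    unfolding o_def by (cases "M = 0") (auto intro!: holomorphic_intros)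
qed

lemma Montel_bounded:
  fixes F :: "nat \<Rightarrow> complex \<Rightarrow> complex"
  assumes "open S" "\<And>n. F n holomorphic_on S" "\<And>n z. z \<in> S \<Longrightarrow> norm (F n z) \<le> B"
  shows "\<exists>g r. g holomorphic_on S \<and> strict_mono (r :: nat \<Rightarrow> nat) \<and>
    (\<forall>x\<in>S. (\<lambda>n. F (r n) x) \<longlonglongrightarrow> g x) \<and>
    (\<forall>K. compact K \<longrightarrow> K \<subseteq> S \<longrightarrow> uniform_limit K (F \<circ> r) g sequentially)"
proof -
  have bd: "\<exists>B. \<forall>h\<in>range F. \<forall>z\<in>K. norm (h z) \<le> B" if "K \<subseteq> S" for K
    using assms(3) that by blast
  show ?thesis
  proof (rule Montel[OF assms(1), of "range F" F])
    fix g and r :: "nat \<Rightarrow> nat"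
    assume "g holomorphic_on S" "strict_mono r" "\<And>x. x \<in> S \<Longrightarrow> (\<lambda>n. F (r n) x) \<longlonglongrightarrow> g x"
      "\<And>K. \<lbrakk>compact K; K \<subseteq> S\<rbrakk> \<Longrightarrow> uniform_limit K (F \<circ> r) g sequentially"
    then show ?thesis by (intro exI[of _ g] exI[of _ r]) simp
  qed (use assms(2) bd in auto)
qed

lemma entire_unbounded_Re:
  assumes "G holomorphic_on UNIV" "G z1 \<noteq> G z2"
  obtains w where "B < Re (G w)"
proof (rule ccontr)
  assume "\<not> thesis"
  then have "\<And>w. Re (G w) \<le> B" using that by (meson not_less)
  then have "G z1 = G 0" "G z2 = G 0" using Re_bounded_above_imp_constant[OF assms(1)] by blast+
  then show False using assms(2) by simp
qed

lemma entire_Re_zero: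
  assumes "G holomorphic_on UNIV" "G z1 \<noteq> G z2"
  obtains p where "Re (G p) = 0"
proof (rule ccontr)
  assume "\<not> thesis"
  then have "\<And>z. Re (G z) \<noteq> 0" using that by blast
  then have "(\<forall>z\<in>UNIV. 0 < Re (G z)) \<or> (\<forall>z\<in>UNIV. Re (G z) < 0)"
    by (intro Re_nonzero_constant_sign holomorphic_on_imp_continuous_on assms) auto
  then have "(\<forall>z. 0 \<le> Re (G z)) \<or> (\<forall>z. Re (G z) \<le> 0)"
    by (auto intro: less_imp_le)
  then show False
    using Re_bounded_above_imp_constant[OF assms(1), of 0] Re_bounded_below_imp_constant[OF assms(1), of 0]
      assms(2) by metis
qed

text \<open>On the doubling discs \<open>Re G\<close> is at most \<open>M n\<close>, and the
  domination hypothesis bounds \<open>Re H\<close> by a multiple of \<open>M n\<close>. Dividing by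
  these bounds and subtracting imaginary constants, invisible in the real parts, gives two bounded
  families; Montel's theorem is applied to one and then to the other along the first subsequence.
  The scale \<open>\<delta> n\<close> is the reciprocal of \<open>M\<close>, which tends to
  infinity, along the final subsequence.\<close>

lemma blow_up:
  assumes G: "G holomorphic_on UNIV" and H: "H holomorphic_on UNIV"
    and nonconst: "G z1 \<noteq> G z2"
    and dom: "\<And>z. \<bar>Re (H z)\<bar> \<le> C * (1 + \<bar>Re (G z)\<bar>)" and C: "0 < C"
  obtains g h a s \<xi> and \<delta> :: "nat \<Rightarrow> real" where
    "g holomorphic_on ball 0 2" "h holomorphic_on ball 0 2"
    "g 0 = 0" "Im (h 0) = 0" "\<xi> \<in> ball 0 2" "g \<xi> \<noteq> 0"
    "\<And>n. 0 < \<delta> n" "\<delta> \<longlonglongrightarrow> 0"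
    "\<And>\<zeta>. \<zeta> \<in> ball 0 2 \<Longrightarrow> (\<lambda>n. \<delta> n * Re (G (a n + s n * \<zeta>))) \<longlonglongrightarrow> Re (g \<zeta>)"
    "\<And>\<zeta>. \<zeta> \<in> ball 0 2 \<Longrightarrow> (\<lambda>n. \<delta> n * Re (H (a n + s n * \<zeta>))) \<longlonglongrightarrow> Re (h \<zeta>)"
proof -
  obtain p where p: "Re (G p) = 0" using entire_Re_zero[OF G nonconst] .
  \<comment> \<open>Translation puts a zero of the real part at the origin, as the construction of
    doubling discs requires.\<close>
  define G1 where "G1 z = G (p + z)" for z
  have G1: "G1 holomorphic_on UNIV"
    using holomorphic_rescaled[OF G, of p 1 0 1] by (simp add: G1_def[abs_def])
  have "\<exists>z r \<gamma> w. 0 < r \<and> Re (G1 z) = 0 \<and> real n + 1 \<le> \<gamma> \<and> dist z w \<le> r \<and> \<gamma> / 2 \<le> \<bar>Re (G1 w)\<bar> \<and>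
     (\<forall>x\<in>ball z (4 * r). \<bar>Re (G1 x)\<bar> \<le> 3 ^ 32 * \<gamma>)" for n
  proof -
    obtain w0 where w0: "real n + 1 < Re (G w0)"
      using entire_unbounded_Re[OF G nonconst] .
    have "Re (G1 (w0 - p)) \<noteq> 0" "Re (G1 0) = 0"
      using w0 p by (auto simp: G1_def)
    from doubling_ball[OF G1 this(2,1)] obtain z r \<gamma> w where 1: "Re (G1 z) = 0" "0 < r"
        "\<bar>Re (G1 (w0 - p))\<bar> \<le> \<gamma>" "dist z w \<le> r" "\<gamma> / 2 \<le> \<bar>Re (G1 w)\<bar>"
        "\<And>x. x \<in> ball z (4 * r) \<Longrightarrow> \<bar>Re (G1 x)\<bar> \<le> 3 ^ 32 * \<gamma>" by metis
    have "real n + 1 \<le> \<gamma>" using 1(3) w0 by (simp add: G1_def)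
    with 1 show ?thesis by blast
  qed
  then obtain z r \<gamma> w where r: "\<And>n. 0 < r n" and z: "\<And>n. Re (G1 (z n)) = 0"
     and \<gamma>: "\<And>n. real n + 1 \<le> \<gamma> n" and w: "\<And>n. dist (z n) (w n) \<le> r n"
       "\<And>n. \<gamma> n / 2 \<le> \<bar>Re (G1 (w n))\<bar>"
     and bd: "\<And>n x. x \<in> ball (z n) (4 * r n) \<Longrightarrow> \<bar>Re (G1 x)\<bar> \<le> 3 ^ 32 * \<gamma> n"
    by metis
  define M where "M n = 3 ^ 32 * \<gamma> n" for n
  have \<gamma>0: "0 < \<gamma> n" for n using \<gamma>[of n] by linarith
  have M1: "real n + 1 \<le> M n" for n
  proof -
    have "1 * \<gamma> n \<le> 3 ^ 32 * \<gamma> n" using \<gamma>0[of n] by (intro mult_right_mono) auto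
    then show ?thesis using \<gamma>[of n] unfolding M_def by linarith
  qed
  have M0: "0 < M n" for n using M1[of n] by linarith
  define a where "a n = p + z n" for n
  define gs where "gs n \<zeta> = (G (a n + of_real (r n) * \<zeta>) - \<i> * Im (G (a n))) / of_real (M n)" for n \<zeta>
  define hs where "hs n \<zeta> = (H (a n + of_real (r n) * \<zeta>) - \<i> * Im (H (a n))) / of_real (2 * C * M n)" for n \<zeta>
  have bdG: "\<bar>Re (G x)\<bar> \<le> M n" if "x \<in> ball (a n) (4 * r n)" for n x
    using bd[of "x - p" n] that by (simp add: G1_def M_def a_def dist_norm algebra_simps)
  \<comment> \<open>Since \<open>M n \<ge> 1\<close>, the summand 1 in the domination hypothesis is
    absorbed into \<open>2 * M n\<close>.\<close>
  have bdH: "\<bar>Re (H x)\<bar> \<le> 2 * C * M n" if "x \<in> ball (a n) (4 * r n)" for n x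
  proof -
    have "\<bar>Re (H x)\<bar> \<le> C * (1 + \<bar>Re (G x)\<bar>)" by (rule dom)
    also have "\<dots> \<le> C * (2 * M n)"
      using C bdG[OF that] M1[of n] by (intro mult_left_mono) auto
    finally show ?thesis by simp
  qed
  have "gs n holomorphic_on ball 0 2" for n
    unfolding gs_def[abs_def] by (rule holomorphic_rescaled[OF G])
  moreover have "norm (gs n \<zeta>) \<le> 11" if "\<zeta> \<in> ball 0 2" for n \<zeta>
    unfolding gs_def by (rule rescaled_bound[OF G bdG r M0]) (use that in auto)
  ultimately obtain g \<rho> where g: "g holomorphic_on ball 0 2" and \<rho>: "strict_mono (\<rho> :: nat \<Rightarrow> nat)"
    and glim: "\<forall>x\<in>ball 0 2. (\<lambda>n. gs (\<rho> n) x) \<longlonglongrightarrow> g x"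
    and gunif: "\<forall>K. compact K \<longrightarrow> K \<subseteq> ball 0 2 \<longrightarrow> uniform_limit K (gs \<circ> \<rho>) g sequentially"
    using Montel_bounded[OF open_ball, where F = gs and B = 11] by blast
  have "hs (\<rho> n) holomorphic_on ball 0 2" for n
    unfolding hs_def[abs_def] by (rule holomorphic_rescaled[OF H])
  moreover have "norm (hs (\<rho> n) \<zeta>) \<le> 11" if "\<zeta> \<in> ball 0 2" for n \<zeta>
    unfolding hs_def by (rule rescaled_bound[OF H bdH r]) (use that M0 C in auto)
  ultimately obtain h \<sigma> where h: "h holomorphic_on ball 0 2" and \<sigma>: "strict_mono (\<sigma> :: nat \<Rightarrow> nat)"
    and hlim: "\<forall>x\<in>ball 0 2. (\<lambda>n. hs (\<rho> (\<sigma> n)) x) \<longlonglongrightarrow> h x"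
    using Montel_bounded[OF open_ball, where F = "\<lambda>n. hs (\<rho> n)" and B = 11] by blast
  define \<tau> where "\<tau> n = \<rho> (\<sigma> n)" for n
  have "strict_mono \<tau>" using strict_mono_o[OF \<rho> \<sigma>] by (simp add: \<tau>_def[abs_def] o_def)
  have za: "Re (G (a n)) = 0" for n using z[of n] by (simp add: G1_def a_def)
  have glim': "(\<lambda>n. gs (\<tau> n) x) \<longlonglongrightarrow> g x" if "x \<in> ball 0 2" for x
    using LIMSEQ_subseq_LIMSEQ[OF bspec[OF glim that] \<sigma>] by (simp add: \<tau>_def o_def)
  have "g 0 = 0"
  proof (rule LIMSEQ_unique[OF glim'])
    have "gs n 0 = 0" for n by (simp add: gs_def complex_eq_iff za)
    then show "(\<lambda>n. gs (\<tau> n) 0) \<longlonglongrightarrow> 0" by simp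
  qed simp
  have "Im (h 0) = 0"
  proof (rule LIMSEQ_unique[OF tendsto_Im[OF bspec[OF hlim]]])
    have "Im (hs n 0) = 0" for n by (simp add: hs_def Im_divide_of_real)
    then show "(\<lambda>n. Im (hs (\<rho> (\<sigma> n)) 0)) \<longlonglongrightarrow> 0" by simp
  qed simp
  \<comment> \<open>The limit cannot vanish identically. At the rescaled position
    \<open>\<omega>\<close> of \<open>w m\<close>, in the closed unit disc, the real part has size
    at least \<open>\<gamma> m / 2 / M m = 1 / (2 * 3 ^ 32)\<close>, whereas uniform convergence to
    0 would make the norm smaller than this.\<close>
  obtain \<xi> where \<xi>: "\<xi> \<in> ball 0 2" "g \<xi> \<noteq> 0"
  proof (rule ccontr)
    assume *: "\<not> thesis"
    have "uniform_limit (cball 0 1) (gs \<circ> \<rho>) g sequentially"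
      by (rule gunif[rule_format]) auto
    then have "\<forall>\<^sub>F n in sequentially. \<forall>x\<in>cball 0 1. dist ((gs \<circ> \<rho>) n x) (g x) < 1 / (2 * 3 ^ 32)"
      by (rule uniform_limitD) simp
    then obtain n where "\<forall>x\<in>cball 0 1. dist ((gs \<circ> \<rho>) n x) (g x) < 1 / (2 * 3 ^ 32)"
      using eventually_happens'[OF sequentially_bot] by blast
    then have n: "dist (gs (\<rho> n) x) (g x) < 1 / (2 * 3 ^ 32)" if "x \<in> cball 0 1" for x
      using that unfolding o_def by blast
    define m where "m = \<rho> n"
    define \<omega> where "\<omega> = (w m - z m) / of_real (r m)"
    have \<omega>: "norm \<omega> \<le> 1"
      using w(1)[of m] r[of m] by (simp add: \<omega>_def norm_divide dist_norm norm_minus_commute)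
    then have "\<omega> \<in> ball 0 2" by simp
    then have "g \<omega> = 0" using * that by blast
    then have "norm (gs m \<omega>) < 1 / (2 * 3 ^ 32)" using n[of \<omega>] \<omega> by (simp add: m_def)
    moreover have "a m + of_real (r m) * \<omega> = p + w m" using r[of m] by (simp add: \<omega>_def a_def)
    then have "Re (gs m \<omega>) = Re (G1 (w m)) / M m"
      by (simp add: gs_def G1_def Re_divide_of_real)
    then have "\<bar>Re (gs m \<omega>)\<bar> = \<bar>Re (G1 (w m))\<bar> / M m"
      using M0[of m] by simp
    moreover have "\<gamma> m / 2 / M m \<le> \<bar>Re (G1 (w m))\<bar> / M m"
      using w(2)[of m] M0[of m] by (intro divide_right_mono) auto
    moreover have "\<gamma> m / 2 / M m = 1 / (2 * 3 ^ 32)"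
      using \<gamma>0[of m] by (simp add: M_def)
    ultimately show False
      using abs_Re_le_cmod[of "gs m \<omega>"] by linarith
  qed
  show thesis
  \<comment> \<open>The factor \<open>2 * C\<close> restores the common scale of the two components,
    since \<open>hs\<close> was divided by \<open>2 * C * M n\<close> and \<open>gs\<close> only by
    \<open>M n\<close>.\<close>
  proof (rule that[where a = "\<lambda>n. a (\<tau> n)" and s = "\<lambda>n. of_real (r (\<tau> n))" and \<delta> = "\<lambda>n. 1 / M (\<tau> n)"
        and g = g and h = "\<lambda>\<zeta>. of_real (2 * C) * h \<zeta>" and \<xi> = \<xi>])
    show "(\<lambda>\<zeta>. of_real (2 * C) * h \<zeta>) holomorphic_on ball 0 2"
      by (intro holomorphic_intros h)
    show "(\<lambda>n. 1 / M (\<tau> n)) \<longlonglongrightarrow> 0"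
    proof -
      have "(\<lambda>n. 1 / M n) \<longlonglongrightarrow> 0"
      proof (rule real_tendsto_sandwich[OF _ _ tendsto_const LIMSEQ_inverse_real_of_nat])
        show "\<forall>\<^sub>F n in sequentially. 0 \<le> 1 / M n" using M0 by (simp add: less_imp_le)
        show "\<forall>\<^sub>F n in sequentially. 1 / M n \<le> inverse (real (Suc n))"
          using M1 M0 by (intro always_eventually allI) (simp add: inverse_eq_divide frac_le add.commute)
      qed
      from LIMSEQ_subseq_LIMSEQ[OF this \<open>strict_mono \<tau>\<close>] show ?thesis by (simp add: o_def)
    qed
    fix \<zeta> :: complex assume \<zeta>: "\<zeta> \<in> ball 0 2"
    have "Re (gs n \<zeta>) = 1 / M n * Re (G (a n + of_real (r n) * \<zeta>))" for n
      by (simp add: gs_def Re_divide_of_real)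
    then show "(\<lambda>n. 1 / M (\<tau> n) * Re (G (a (\<tau> n) + of_real (r (\<tau> n)) * \<zeta>))) \<longlonglongrightarrow> Re (g \<zeta>)"
      using tendsto_Re[OF glim'[OF \<zeta>]] by simp
    have "2 * C * Re (hs n \<zeta>) = 1 / M n * Re (H (a n + of_real (r n) * \<zeta>))" for n
      using C by (simp add: hs_def Re_divide_of_real del: of_real_mult)
    moreover have "(\<lambda>n. 2 * C * Re (hs (\<tau> n) \<zeta>)) \<longlonglongrightarrow> 2 * C * Re (h \<zeta>)"
      unfolding \<tau>_def by (intro tendsto_intros bspec[OF hlim] \<zeta>)
    ultimately show "(\<lambda>n. 1 / M (\<tau> n) * Re (H (a (\<tau> n) + of_real (r (\<tau> n)) * \<zeta>)))
        \<longlonglongrightarrow> Re (of_real (2 * C) * h \<zeta>)"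
      by simp
  qed (use g \<open>g 0 = 0\<close> \<open>Im (h 0) = 0\<close> \<xi> M0 in auto)
qed

subsection \<open>Asymptotic directions\<close>

text \<open>A form without sequences: it makes closedness an \<open>e / 2\<close> argument, and its
  negation supplies a uniform gap \<open>e\<close>.\<close>

lemma asymptotic_direction_iff:
  "asymptotic_direction R \<zeta> \<longleftrightarrow>
     norm \<zeta> = 1 \<and> (\<forall>e>0. \<exists>w\<in>R. \<exists>t>0. t < e \<and> norm (of_real t * w - \<zeta>) < e)"
proof (intro iffI conjI allI impI)
  fix e :: real
  assume "asymptotic_direction R \<zeta>" and e: "0 < e"
  then obtain w \<epsilon> where w: "\<And>n::nat. w n \<in> R" "\<And>n. 0 < \<epsilon> n" and lim: "\<epsilon> \<longlonglongrightarrow> 0"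
      "(\<lambda>n. of_real (\<epsilon> n) * w n) \<longlonglongrightarrow> \<zeta>"
    unfolding asymptotic_direction_def by blast
  have "\<forall>\<^sub>F n in sequentially. dist (\<epsilon> n) 0 < e \<and> dist (of_real (\<epsilon> n) * w n) \<zeta> < e"
    using tendstoD[OF lim(1) e] tendstoD[OF lim(2) e] by (rule eventually_conj)
  then obtain n where "dist (\<epsilon> n) 0 < e" "dist (of_real (\<epsilon> n) * w n) \<zeta> < e"
    by (auto simp: eventually_sequentially)
  then show "\<exists>w\<in>R. \<exists>t>0. t < e \<and> norm (of_real t * w - \<zeta>) < e"
    using w[of n] by (auto simp: dist_norm intro!: bexI[of _ "w n"] exI[of _ "\<epsilon> n"])
next
  assume *: "norm \<zeta> = 1 \<and> (\<forall>e>0. \<exists>w\<in>R. \<exists>t>0. t < e \<and> norm (of_real t * w - \<zeta>) < e)"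
  have "\<exists>w t. w \<in> R \<and> 0 < t \<and> t < inverse (real (Suc n)) \<and> norm (of_real t * w - \<zeta>) < inverse (real (Suc n))" for n
    using * by (metis inverse_positive_iff_positive of_nat_0_less_iff zero_less_Suc)
  then obtain w t where w: "\<And>n. w n \<in> R" and t: "\<And>n. 0 < t n" "\<And>n. t n < inverse (real (Suc n))"
    and wt: "\<And>n. norm (of_real (t n) * w n - \<zeta>) < inverse (real (Suc n))"
    by metis
  have "t \<longlonglongrightarrow> 0"
    by (rule real_tendsto_sandwich[OF _ _ tendsto_const LIMSEQ_inverse_real_of_nat])
      (use t in \<open>auto simp: less_imp_le\<close>)
  moreover have "(\<lambda>n. of_real (t n) * w n - \<zeta>) \<longlonglongrightarrow> 0"
    by (rule Lim_null_comparison[OF _ LIMSEQ_inverse_real_of_nat]) (use wt in \<open>auto simp: less_imp_le\<close>)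
  then have "(\<lambda>n. of_real (t n) * w n) \<longlonglongrightarrow> \<zeta>"
    by (simp add: LIM_zero_iff)
  ultimately show "asymptotic_direction R \<zeta>"
    unfolding asymptotic_direction_def using * w t by blast
qed (auto simp: asymptotic_direction_def)

lemma closed_asymptotic_directions: "closed (asymptotic_directions R)"
proof (unfold closed_sequential_limits, intro allI impI)
  fix x \<zeta> assume "(\<forall>n. x n \<in> asymptotic_directions R) \<and> x \<longlonglongrightarrow> \<zeta>"
  then have x: "\<And>n. asymptotic_direction R (x n)" and lim: "x \<longlonglongrightarrow> \<zeta>"
    by (auto simp: asymptotic_directions_def)
  have "(\<lambda>n. norm (x n)) \<longlonglongrightarrow> norm \<zeta>" by (intro tendsto_intros lim)
  moreover have "norm (x n) = 1" for n using x[of n] by (simp add: asymptotic_direction_def)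
  ultimately have "norm \<zeta> = 1" by (simp add: LIMSEQ_const_iff)
  moreover have "\<exists>w\<in>R. \<exists>t>0. t < e \<and> norm (of_real t * w - \<zeta>) < e" if e: "0 < e" for e
  proof -
    obtain n where n: "norm (x n - \<zeta>) < e / 2"
      using tendstoD[OF lim, of "e / 2"] e by (auto simp: eventually_sequentially dist_norm)
    obtain w t where wt: "w \<in> R" "0 < t" "t < e / 2" "norm (of_real t * w - x n) < e / 2"
      using x[of n] e unfolding asymptotic_direction_iff by (meson half_gt_zero)
    have "norm (of_real t * w - \<zeta>) < e"
      using norm_diff_triangle_less[OF wt(4) n] by simp
    with wt e show ?thesis by (auto intro!: bexI[of _ w] exI[of _ t])
  qed
  ultimately show "\<zeta> \<in> asymptotic_directions R"
    by (simp add: asymptotic_directions_def asymptotic_direction_iff)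
qed

lemma asymptotic_direction_rotate:
  assumes "asymptotic_direction ((*) c ` R) \<zeta>" and c: "norm c = 1"
  shows "asymptotic_direction R (cnj c * \<zeta>)"
proof -
  have cc: "cnj c * (c * y) = y" for y
    using c complex_norm_square[of c] by (simp add: mult.assoc[symmetric] mult.commute[of "cnj c"])
  obtain w \<epsilon> where w: "\<And>n::nat. w n \<in> (*) c ` R" "\<And>n. 0 < \<epsilon> n" and lim: "\<epsilon> \<longlonglongrightarrow> 0"
      "(\<lambda>n. of_real (\<epsilon> n) * w n) \<longlonglongrightarrow> \<zeta>" and \<zeta>: "norm \<zeta> = 1"
    using assms(1) unfolding asymptotic_direction_def by blast
  have "(\<lambda>n. cnj c * (of_real (\<epsilon> n) * w n)) \<longlonglongrightarrow> cnj c * \<zeta>"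
    by (intro tendsto_intros lim)
  then have "(\<lambda>n. of_real (\<epsilon> n) * (cnj c * w n)) \<longlonglongrightarrow> cnj c * \<zeta>"
    by (simp add: mult.left_commute)
  moreover have "cnj c * w n \<in> R" for n
  proof -
    obtain x where "w n = c * x" "x \<in> R" using w(1) by blast
    then show ?thesis by (simp only: cc)
  qed
  moreover have "norm (cnj c * \<zeta>) = 1" using c \<zeta> by (simp add: norm_mult)
  ultimately show ?thesis
    unfolding asymptotic_direction_def using w(2) lim(1)
    by (intro conjI exI[of _ "\<lambda>n. cnj c * w n"] exI[of _ \<epsilon>]) auto
qed

text \<open>Otherwise the set of directions and its negative would be two disjoint nonempty closed
  sets covering the circle, which is connected.\<close>

lemma obtain_antipodal_non_directions:
  assumes "\<And>\<zeta>. asymptotic_direction R \<zeta> \<Longrightarrow> \<not> asymptotic_direction R (- \<zeta>)"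
  obtains b where "norm b = 1" "\<not> asymptotic_direction R b" "\<not> asymptotic_direction R (- b)"
proof (rule ccontr)
  assume "\<not> thesis"
  then have cover: "asymptotic_direction R b \<or> asymptotic_direction R (- b)" if "norm b = 1" for b
    using that \<open>\<And>b. \<lbrakk>norm b = 1; \<not> asymptotic_direction R b; \<not> asymptotic_direction R (- b)\<rbrakk> \<Longrightarrow> thesis\<close> by blast
  define D where "D = asymptotic_directions R"
  have D: "\<zeta> \<in> D \<longleftrightarrow> asymptotic_direction R \<zeta>" for \<zeta>
    by (simp add: D_def asymptotic_directions_def)
  have mD: "\<zeta> \<in> uminus ` D \<longleftrightarrow> - \<zeta> \<in> D" for \<zeta>
    by (metis imageE imageI minus_minus)
  have "closed D" unfolding D_def by (rule closed_asymptotic_directions)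
  moreover have "closed (uminus ` D)"
    by (rule closed_negations) fact
  moreover have "sphere 0 1 \<subseteq> D \<union> uminus ` D"
  proof
    fix x :: complex assume "x \<in> sphere 0 1"
    then show "x \<in> D \<union> uminus ` D" using cover[of x] by (simp add: D mD)
  qed
  moreover have "D \<inter> uminus ` D \<inter> sphere 0 1 = {}"
    using assms by (auto simp: D mD)
  moreover have "connected (sphere (0::complex) 1)"
    by (rule connected_sphere) simp
  ultimately have "D \<inter> sphere 0 1 = {} \<or> uminus ` D \<inter> sphere 0 1 = {}"
    unfolding connected_closed by blast
  moreover obtain b where "b \<in> D" "norm b = 1"
  proof -
    have "1 \<in> D \<or> - 1 \<in> D" using cover[of 1] by (simp add: D)
    then show thesis using that by fastforce
  qed
  moreover have "- b \<in> uminus ` D \<inter> sphere 0 1" "b \<in> D \<inter> sphere 0 1"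
    using \<open>b \<in> D\<close> \<open>norm b = 1\<close> by auto
  ultimately show False by blast
qed

text \<open>Points whose imaginary part is large in absolute value and not controlled by the real
  part would, once scaled to imaginary part 1 or -1, come arbitrarily close to \<open>\<i>\<close>
  or \<open>- \<i>\<close>.\<close>

lemma Im_dominated_by_Re:
  assumes "\<not> asymptotic_direction R \<i>" "\<not> asymptotic_direction R (- \<i>)"
  obtains C where "0 < C" "\<And>w. w \<in> R \<Longrightarrow> \<bar>Im w\<bar> \<le> C * (1 + \<bar>Re w\<bar>)"
proof -
  obtain e1 where e1: "0 < e1" "\<And>w t. \<lbrakk>w \<in> R; 0 < t; t < e1\<rbrakk> \<Longrightarrow> e1 \<le> norm (of_real t * w - \<i>)"
    using assms(1) unfolding asymptotic_direction_iff by (metis norm_ii not_less)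
  obtain e2 where e2: "0 < e2" "\<And>w t. \<lbrakk>w \<in> R; 0 < t; t < e2\<rbrakk> \<Longrightarrow> e2 \<le> norm (of_real t * w - (- \<i>))"
    using assms(2) unfolding asymptotic_direction_iff by (metis norm_ii norm_minus_cancel not_less)
  define e where "e = min e1 e2"
  have e: "0 < e" "e \<le> e1" "e \<le> e2" using e1 e2 by (auto simp: e_def)
  show thesis
  proof
    show "0 < 1 / e" using e by simp
    fix w assume w: "w \<in> R"
    show "\<bar>Im w\<bar> \<le> 1 / e * (1 + \<bar>Re w\<bar>)"
    proof (cases "\<bar>Im w\<bar> \<le> 1 / e")
      case True
      moreover have "0 \<le> 1 / e * \<bar>Re w\<bar>" using e by simp
      ultimately show ?thesis by (simp add: distrib_left)
    next
      case False
      \<comment> \<open>With this scaling \<open>of_real t * w\<close> differs from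
        \<open>\<i>\<close> or from \<open>- \<i>\<close> only by the real number
        \<open>t * Re w\<close>.\<close>
      define t where "t = 1 / \<bar>Im w\<bar>"
      have I: "0 < \<bar>Im w\<bar>" "1 / e < \<bar>Im w\<bar>" using False e by (auto simp: not_le intro: less_trans[of 0 "1/e"])
      then have t: "0 < t" "t < e" using e by (auto simp: t_def field_simps)
      have "of_real t * w - \<i> = of_real (t * Re w) \<or> of_real t * w - (- \<i>) = of_real (t * Re w)"
        using I(1) by (cases "0 < Im w") (auto simp: t_def complex_eq_iff)
      then have "e \<le> t * \<bar>Re w\<bar>"
      proof
        assume "of_real t * w - \<i> = of_real (t * Re w)"
        then have "norm (of_real t * w - \<i>) = t * \<bar>Re w\<bar>"
          using t by (simp only: norm_of_real abs_mult abs_of_pos)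
        then show ?thesis using e1(2)[OF w t(1)] t e by linarith
      next
        assume "of_real t * w - (- \<i>) = of_real (t * Re w)"
        then have "norm (of_real t * w - (- \<i>)) = t * \<bar>Re w\<bar>"
          using t by (simp only: norm_of_real abs_mult abs_of_pos)
        then show ?thesis using e2(2)[OF w t(1)] t e by linarith
      qed
      then have "\<bar>Im w\<bar> \<le> 1 / e * \<bar>Re w\<bar>"
        using I e by (simp add: t_def field_simps)
      moreover have "0 < 1 / e" using e by simp
      ultimately show ?thesis unfolding distrib_left by linarith
    qed
  qed
qed

section \<open>Leading terms at a common zero\<close>

text \<open>The exponent \<open>n\<close> is the smaller of the two orders of vanishing, or that of
  \<open>g\<close> alone when \<open>h\<close> is identically zero.\<close>

lemma holomorphic_pair_factor_zero:
  assumes g: "g holomorphic_on S" and h: "h holomorphic_on S"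
    and S: "open S" "connected S" "0 \<in> S"
    and 0: "g 0 = 0" "h 0 = 0" and nz: "\<zeta> \<in> S" "g \<zeta> \<noteq> 0"
  obtains n r g1 h1 where "0 < n" "0 < r" "ball 0 r \<subseteq> S" "isCont g1 0" "isCont h1 0"
    "\<And>z. z \<in> ball 0 r \<Longrightarrow> g z = z ^ n * g1 z" "\<And>z. z \<in> ball 0 r \<Longrightarrow> h z = z ^ n * h1 z"
    "g1 0 \<noteq> 0 \<or> h1 0 \<noteq> (0::complex)"
proof -
  have cont: "isCont f 0" if "f holomorphic_on ball 0 r" "0 < r" for f :: "complex \<Rightarrow> complex" and r
    using holomorphic_on_imp_continuous_on[OF that(1)] that(2)
    by (simp add: continuous_on_eq_continuous_at)
  have "\<not> g constant_on S" using 0 nz S unfolding constant_on_def by metis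
  from holomorphic_factor_zero_nonconstant[OF g S(1,2,3) 0(1) this]
  obtain g1 r m where g1: "0 < m" "0 < r" "ball 0 r \<subseteq> S" "g1 holomorphic_on ball 0 r"
      "\<And>w. w \<in> ball 0 r \<Longrightarrow> g w = (w - 0) ^ m * g1 w" "\<And>w. w \<in> ball 0 r \<Longrightarrow> g1 w \<noteq> 0" by metis
  show thesis
  proof (cases "h constant_on S")
    case True
    then have "h z = 0" if "z \<in> S" for z using that 0 S unfolding constant_on_def by metis
    then show thesis
      using g1 by (intro that[of m r g1 "\<lambda>_. 0"] cont[of _ r]) (auto simp: subset_iff)
  next
    case False
    from holomorphic_factor_zero_nonconstant[OF h S(1,2,3) 0(2) this]
    obtain h1 r' k where h1: "0 < k" "0 < r'" "ball 0 r' \<subseteq> S" "h1 holomorphic_on ball 0 r'"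
      "\<And>w. w \<in> ball 0 r' \<Longrightarrow> h w = (w - 0) ^ k * h1 w" "\<And>w. w \<in> ball 0 r' \<Longrightarrow> h1 w \<noteq> 0" by metis
    define n where "n = min m k"
    have n: "m = n + (m - n)" "k = n + (k - n)" "m - n = 0 \<or> k - n = 0" by (auto simp: n_def)
    have c: "isCont g1 0" "isCont h1 0" using cont g1 h1 by blast+
    show thesis
    proof (rule that[of n "min r r'" "\<lambda>z. z ^ (m - n) * g1 z" "\<lambda>z. z ^ (k - n) * h1 z"])
      show "g z = z ^ n * (z ^ (m - n) * g1 z)" if "z \<in> ball 0 (min r r')" for z
        using g1(5)[of z] that n(1) by (simp add: mult.assoc[symmetric] power_add[symmetric])
      show "h z = z ^ n * (z ^ (k - n) * h1 z)" if "z \<in> ball 0 (min r r')" for z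
        using h1(5)[of z] that n(2) by (simp add: mult.assoc[symmetric] power_add[symmetric])
      \<comment> \<open>One of the two exponents is 0, and \<open>0 ^ 0 = 1\<close> leaves a nonzero
        factor.\<close>
      show "0 ^ (m - n) * g1 0 \<noteq> 0 \<or> 0 ^ (k - n) * h1 0 \<noteq> 0"
        using n(3) g1(6)[of 0] h1(6)[of 0] g1(2) h1(2) by auto
    qed (use g1 h1 c in \<open>auto simp: n_def intro!: continuous_intros\<close>)
  qed
qed

text \<open>The leading homogeneous term of \<open>Complex (Re g) (Re h)\<close> at \<open>0\<close> takes the values \<open>p \<eta>\<close> with
  \<open>p\<close> real linear, hence with each value also its negative.\<close>
lemma antipodal_values_near_zero:
  assumes g: "g holomorphic_on S" and h: "h holomorphic_on S"
    and S: "open S" "connected S" "0 \<in> S"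
    and 0: "g 0 = 0" "h 0 = 0" and nz: "\<zeta> \<in> S" "g \<zeta> \<noteq> 0"
    and D: "closed D" "\<And>z. \<lbrakk>z \<in> S; Complex (Re (g z)) (Re (h z)) \<noteq> 0\<rbrakk> \<Longrightarrow> sgn (Complex (Re (g z)) (Re (h z))) \<in> D"
  obtains d where "norm d = 1" "d \<in> D" "- d \<in> D"
proof -
  obtain n r g1 h1 where n: "0 < n" and r: "0 < r" "ball 0 r \<subseteq> S" and cont: "isCont g1 0" "isCont h1 0"
    and gz: "\<And>z. z \<in> ball 0 r \<Longrightarrow> g z = z ^ n * g1 z" and hz: "\<And>z. z \<in> ball 0 r \<Longrightarrow> h z = z ^ n * h1 z"
    and nz: "g1 0 \<noteq> 0 \<or> h1 0 \<noteq> 0"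
    using holomorphic_pair_factor_zero[OF g h S 0 nz] by metis
  define p where "p \<eta> = Complex (Re (\<eta> * g1 0)) (Re (\<eta> * h1 0))" for \<eta>
  have pD: "sgn (p \<eta>) \<in> D" if p: "p \<eta> \<noteq> 0" for \<eta>
  proof -
    \<comment> \<open>Approaching 0 along the ray through an \<open>n\<close>-th root of
      \<open>\<eta>\<close>, the power \<open>x k ^ n\<close> is a positive multiple of
      \<open>\<eta>\<close>; positive factors do not affect \<open>sgn\<close>.\<close>
    obtain \<omega> where \<omega>: "\<eta> = \<omega> ^ n" using exists_complex_root[of n \<eta>] n by auto
    define x where "x k = of_real (inverse (real (Suc k))) * \<omega>" for k
    define q where "q k = Complex (Re (\<eta> * g1 (x k))) (Re (\<eta> * h1 (x k)))" for k
    have "x \<longlonglongrightarrow> of_real 0 * \<omega>"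
      unfolding x_def by (intro tendsto_intros LIMSEQ_inverse_real_of_nat)
    then have x0: "x \<longlonglongrightarrow> 0" by simp
    have "q \<longlonglongrightarrow> p \<eta>"
      unfolding q_def p_def
      by (intro tendsto_intros isCont_tendsto_compose[OF cont(1) x0] isCont_tendsto_compose[OF cont(2) x0])
    then have lim: "(\<lambda>k. sgn (q k)) \<longlonglongrightarrow> sgn (p \<eta>)" and nzq: "\<forall>\<^sub>F k in sequentially. q k \<noteq> 0"
      using p by (auto intro: tendsto_sgn tendsto_imp_eventually_ne)
    have small: "\<forall>\<^sub>F k in sequentially. x k \<in> ball 0 r"
      using tendstoD[OF x0 r(1)] by simp
    have "\<forall>\<^sub>F k in sequentially. sgn (q k) \<in> D"
      using nzq small
    proof eventually_elim
      case (elim k)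
      define t where "t = inverse (real (Suc k)) ^ n"
      have t: "0 < t" by (simp add: t_def)
      have "x k ^ n = of_real t * \<eta>" by (simp add: x_def \<omega> t_def power_mult_distrib)
      then have "Complex (Re (g (x k))) (Re (h (x k))) = of_real t * q k"
        using elim by (simp add: gz hz q_def complex_eq_iff mult.assoc algebra_simps)
      moreover have "x k \<in> S" using elim r by auto
      ultimately have "sgn (of_real t * q k) \<in> D" using D(2)[of "x k"] elim t by simp
      then show ?case using t by (simp add: sgn_mult sgn_of_real)
    qed
    then show ?thesis
      using Lim_in_closed_set[OF D(1) _ _ lim] by simp
  qed
  \<comment> \<open>A conjugate is the witness that \<open>p\<close> is not identically zero:
    \<open>cnj a * a\<close> is the squared modulus of \<open>a\<close>.\<close>
  have "Re (cnj a * a) \<noteq> 0" if "a \<noteq> 0" for a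
    using that by (simp add: complex_eq_iff sum_squares_eq_zero_iff)
  then have "p (cnj (g1 0)) \<noteq> 0 \<or> p (cnj (h1 0)) \<noteq> 0"
    using nz by (auto simp: p_def Complex_eq_0)
  then obtain \<eta> where \<eta>: "p \<eta> \<noteq> 0" by blast
  have m: "p (- \<eta>) = - p \<eta>" by (simp add: p_def complex_eq_iff)
  show thesis
  proof (rule that[of "sgn (p \<eta>)"])
    show "- sgn (p \<eta>) \<in> D" using pD[of "- \<eta>"] \<eta> m by (simp add: sgn_minus)
  qed (use \<eta> pD in \<open>auto simp: norm_sgn\<close>)
qed

section \<open>Constancy without vertical directions, and rotation to that case\<close>

text \<open>If \<open>G\<close> is not constant, the blow-up limit takes values in antipodal
  asymptotic directions, a contradiction. If \<open>G\<close> is constant, the domination bounds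
  \<open>Re H\<close>, and Liouville's theorem makes \<open>H\<close> constant as well.\<close>

lemma Re_pair_constant_if_no_vertical_direction:
  fixes G H :: "complex \<Rightarrow> complex"
  defines "f \<equiv> \<lambda>z. Complex (Re (G z)) (Re (H z))"
  assumes G: "G holomorphic_on UNIV" and H: "H holomorphic_on UNIV"
    and anti: "\<And>\<zeta>. asymptotic_direction (range f) \<zeta> \<Longrightarrow> \<not> asymptotic_direction (range f) (- \<zeta>)"
    and ni: "\<not> asymptotic_direction (range f) \<i>" "\<not> asymptotic_direction (range f) (- \<i>)"
  shows "f z = f 0"
proof -
  obtain C where C: "0 < C" and dom': "\<And>w. w \<in> range f \<Longrightarrow> \<bar>Im w\<bar> \<le> C * (1 + \<bar>Re w\<bar>)"
    using Im_dominated_by_Re[OF ni] by blast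
  have dom: "\<bar>Re (H z)\<bar> \<le> C * (1 + \<bar>Re (G z)\<bar>)" for z
    using dom'[of "f z"] by (simp add: f_def)
  have Gc: "G z1 = G z2" for z1 z2
  proof (rule ccontr)
    assume "G z1 \<noteq> G z2"
    then show False
    proof (rule blow_up[OF G H _ dom C])
      fix g h a s \<xi> and \<delta> :: "nat \<Rightarrow> real"
      assume gh: "g holomorphic_on ball 0 2" "h holomorphic_on ball 0 2"
        and g0: "g 0 = 0" "Im (h 0) = 0" and \<xi>: "\<xi> \<in> ball 0 2" "g \<xi> \<noteq> 0"
        and \<delta>: "\<And>n. 0 < \<delta> n" "\<delta> \<longlonglongrightarrow> 0"
        and lim: "\<And>\<zeta>. \<zeta> \<in> ball 0 2 \<Longrightarrow> (\<lambda>n. \<delta> n * Re (G (a n + s n * \<zeta>))) \<longlonglongrightarrow> Re (g \<zeta>)"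
          "\<And>\<zeta>. \<zeta> \<in> ball 0 2 \<Longrightarrow> (\<lambda>n. \<delta> n * Re (H (a n + s n * \<zeta>))) \<longlonglongrightarrow> Re (h \<zeta>)"
      define F where "F \<zeta> = Complex (Re (g \<zeta>)) (Re (h \<zeta>))" for \<zeta>
      \<comment> \<open>Because \<open>\<delta>\<close> tends to 0, the numbers
        \<open>\<delta> n / norm (F \<zeta>)\<close> serve as the scales in the definition of an
        asymptotic direction.\<close>
      have FD: "asymptotic_direction (range f) (sgn (F \<zeta>))" if "\<zeta> \<in> ball 0 2" "F \<zeta> \<noteq> 0" for \<zeta>
      proof -
        have "(\<lambda>n. Complex (\<delta> n * Re (G (a n + s n * \<zeta>))) (\<delta> n * Re (H (a n + s n * \<zeta>)))) \<longlonglongrightarrow> F \<zeta>"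
          unfolding F_def by (intro tendsto_intros lim that)
        then have "(\<lambda>n. of_real (\<delta> n) * f (a n + s n * \<zeta>)) \<longlonglongrightarrow> F \<zeta>"
          by (simp add: f_def complex_of_real_mult_Complex)
        then have "(\<lambda>n. of_real (\<delta> n) * f (a n + s n * \<zeta>) / of_real (norm (F \<zeta>))) \<longlonglongrightarrow> F \<zeta> / of_real (norm (F \<zeta>))"
          using that by (intro tendsto_intros) auto
        then have "(\<lambda>n. of_real (\<delta> n / norm (F \<zeta>)) * f (a n + s n * \<zeta>)) \<longlonglongrightarrow> sgn (F \<zeta>)"
          by (simp add: sgn_eq)
        moreover have "(\<lambda>n. \<delta> n / norm (F \<zeta>)) \<longlonglongrightarrow> 0"
          using tendsto_divide_zero[OF \<delta>(2)] by simp
        ultimately show ?thesis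
          unfolding asymptotic_direction_def using that \<delta>(1) norm_sgn[of "F \<zeta>"]
          by (intro conjI exI[of _ "\<lambda>n. f (a n + s n * \<zeta>)"] exI[of _ "\<lambda>n. \<delta> n / norm (F \<zeta>)"]) auto
      qed
      \<comment> \<open>As \<open>g 0 = 0\<close>, a nonzero \<open>F 0\<close> would be purely
        imaginary and point in one of the excluded directions \<open>\<i>\<close> and
        \<open>- \<i>\<close>.\<close>
      have "h 0 = 0"
      proof (rule ccontr)
        assume "h 0 \<noteq> 0"
        then have nz: "Re (h 0) \<noteq> 0" using g0 by (simp add: complex_eq_iff)
        have F0: "F 0 = of_real (Re (h 0)) * \<i>" by (simp add: F_def g0 complex_eq_iff)
        then have "sgn (F 0) = of_real (sgn (Re (h 0))) * \<i>"
          by (simp add: sgn_mult sgn_of_real sgn_eq[of \<i>])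
        then have "sgn (F 0) = \<i> \<or> sgn (F 0) = - \<i>" using nz by (auto simp: sgn_if)
        moreover have "F 0 \<noteq> 0" using nz F0 by simp
        ultimately show False using FD[of 0] ni by auto
      qed
      obtain d where "d \<in> asymptotic_directions (range f)" "- d \<in> asymptotic_directions (range f)"
      proof (rule antipodal_values_near_zero[OF gh _ _ _ g0(1) \<open>h 0 = 0\<close> \<xi> closed_asymptotic_directions])
        show "sgn (Complex (Re (g z)) (Re (h z))) \<in> asymptotic_directions (range f)"
          if "z \<in> ball 0 2" "Complex (Re (g z)) (Re (h z)) \<noteq> 0" for z
          using FD[of z] that by (simp add: F_def asymptotic_directions_def)
      qed (use that in auto)
      then show False using anti by (auto simp: asymptotic_directions_def)
    qed
  qed
  have "Re (H z) \<le> C * (1 + \<bar>Re (G 0)\<bar>)" for z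
    using dom[of z] Gc[of z 0] by simp
  then have "H z = H 0" by (rule Re_bounded_above_imp_constant[OF H])
  then show ?thesis using Gc[of z 0] by (simp add: f_def)
qed

theorem theorem1:
  fixes u v :: "complex \<Rightarrow> real"
  assumes "harmonic u" and "harmonic v"
    and "\<not> (\<exists>\<zeta>. norm \<zeta> = 1 \<and>
              \<zeta> \<in> asymptotic_directions (range (\<lambda>z. complex_of_real (u z) + \<i> * complex_of_real (v z))) \<and>
              - \<zeta> \<in> asymptotic_directions (range (\<lambda>z. complex_of_real (u z) + \<i> * complex_of_real (v z))))"
  shows "\<exists>c. \<forall>z. complex_of_real (u z) + \<i> * complex_of_real (v z) = c"
proof -
  define f where "f = (\<lambda>z. complex_of_real (u z) + \<i> * complex_of_real (v z))"
  have anti: "\<not> asymptotic_direction (range f) (- \<zeta>)" if "asymptotic_direction (range f) \<zeta>" for \<zeta>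
  proof -
    have "norm \<zeta> = 1" using that by (simp add: asymptotic_direction_def)
    then show ?thesis
      using assms(3) that unfolding asymptotic_directions_def f_def[symmetric] by blast
  qed
  obtain G where G: "G holomorphic_on UNIV" "\<And>z. u z = Re (G z)"
    using harmonic_imp_Re_entire[OF assms(1)] by blast
  obtain H where H: "H holomorphic_on UNIV" "\<And>z. v z = Re (H z)"
    using harmonic_imp_Re_entire[OF assms(2)] by blast
  obtain b where b: "norm b = 1" "\<not> asymptotic_direction (range f) b" "\<not> asymptotic_direction (range f) (- b)"
    using obtain_antipodal_non_directions[OF anti] by blast
  \<comment> \<open>Multiplication by \<open>c\<close> is the rotation taking \<open>b\<close> to
    \<open>\<i>\<close>.\<close>
  define c where "c = \<i> * cnj b"
  have c: "norm c = 1" "c \<noteq> 0" using b by (auto simp: c_def norm_mult)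
  have cnjc: "cnj c * \<i> = b" by (simp add: c_def complex_eq_iff)
  \<comment> \<open>The rotation mixes the two real parts with real coefficients, so the same
    combinations of \<open>G\<close> and \<open>H\<close> are entire and have the components of
    \<open>c * f z\<close> as real parts.\<close>
  define G' where "G' z = of_real (Re c) * G z - of_real (Im c) * H z" for z
  define H' where "H' z = of_real (Im c) * G z + of_real (Re c) * H z" for z
  have f': "Complex (Re (G' z)) (Re (H' z)) = c * f z" for z
    by (simp add: G'_def H'_def f_def G H complex_eq_iff)
  have dir: "asymptotic_direction (range f) (cnj c * \<zeta>)"
    if "asymptotic_direction (range (\<lambda>z. Complex (Re (G' z)) (Re (H' z)))) \<zeta>" for \<zeta>
  proof (rule asymptotic_direction_rotate[OF _ c(1)])
    show "asymptotic_direction ((*) c ` range f) \<zeta>"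
      using that unfolding f' by (simp add: image_image)
  qed
  have "Complex (Re (G' z)) (Re (H' z)) = Complex (Re (G' 0)) (Re (H' 0))" for z
  proof (rule Re_pair_constant_if_no_vertical_direction)
    show "G' holomorphic_on UNIV" "H' holomorphic_on UNIV"
      unfolding G'_def H'_def by (intro holomorphic_intros G H)+
  qed (use dir[of \<i>] dir[of "- \<i>"] dir anti b cnjc in \<open>fastforce\<close>)+
  then have "c * f z = c * f 0" for z by (simp only: f')
  then have "f z = f 0" for z using c by simp
  then show ?thesis unfolding f_def by blast
qed

end
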